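(* Let $(X,\|\cdot\|)$ be a real Banach space with $\dim X>1$, let $\tau_w$ be the weak topology on $X$, and let $\rho$ be the projective equivalence relation on $X\setminus\{0\}$. Then there exist a family $\mathcal{F}$ of $\tau_w$-continuous real-valued functions on $X$ and a $\rho$-admissible subset $\mathcal{A}_X$ of $X$ such that $\mathcal{P}_B=\mathcal{P}_{(\tau_w,\mathcal{F},\mathcal{A}_X)}$; in other words, Birkhoff-James orthogonality is equivalent to $\perp_{(\tau_w,\mathcal{F},\mathcal{A}_X)}$.
   Context: Projective relation: for $u,v\in X\setminus\{0\}$, $u\,\rho\,v$ iff $u=tv$ for some non-zero $t\in\mathbb{R}$. A subset $\mathcal{A}_X\subset X$ is $\rho$-admissible if it consists of exactly one element from each equivalence class of $\rho$. For non-zero $x\in X$, $a_x$ denotes the unique element of $\mathcal{A}_X$ equivalent to $x$. Orthogonality: let $\tau$ be a topology on $X$, $\mathcal{F}$ a family of continuous functions $(X,\tau)\to\mathbb{R}$ (with $\mathbb{R}$ carrying the usual topology), and $\mathcal{A}_X$ a $\rho$-admissible set. For $u,v\in\mathcal{A}_X$, $u\perp_{(\tau,\mathcal{F},\mathcal{A}_X)}v$ means that there is $f\in\mathcal{F}$ with (i) $f(u)=\sup_{z\in\mathcal{A}_X}|f(z)|$ and (ii) $f(\lambda v)=0$ for all $\lambda\in\mathbb{R}$. For non-zero $x,y\in X$, $x\perp_{(\tau,\mathcal{F},\mathcal{A}_X)}y$ means $a_x\perp_{(\tau,\mathcal{F},\mathcal{A}_X)}a_y$. If $x=0$ or $y=0$,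 then $x\perp_{(\tau,\mathcal{F},\mathcal{A}_X)}y$ holds by definition. Put $\mathcal{P}_{(\tau,\mathcal{F},\mathcal{A}_X)}=\{(x,y)\in X\times X: x\perp_{(\tau,\mathcal{F},\mathcal{A}_X)}y\}$. Birkhoff-James orthogonality in $(X,\|\cdot\|)$: $x\perp_B y$ iff $\|x\|\le\|x+\lambda y\|$ for all $\lambda\in\mathbb{R}$; $\mathcal{P}_B=\{(x,y)\in X\times X: x\perp_B y\}$. *)

theory Defs
  imports "HOL-Analysis.Analysis"
begin

text \<open>The coarsest topology on the whole type for which every bounded linear functional is
  continuous.\<close>

definition weak_topology :: "'a::real_normed_vector topology" where
  "weak_topology =
     topology_generated_by {f -` U | (f :: 'a \<Rightarrow> real) U. bounded_linear f \<and> open U}"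

lemma topspace_weak_topology [simp]: "topspace weak_topology = UNIV"
proof -
  have "UNIV = (\<lambda>_::'a. 0::real) -` UNIV" by simp
  then have "UNIV \<in> {f -` U | (f :: 'a \<Rightarrow> real) U. bounded_linear f \<and> open U}"
    using bounded_linear_zero open_UNIV by blast
  then show ?thesis
    unfolding weak_topology_def topology_generated_by_topspace by blast
qed

definition proj_rel :: "('a::real_vector \<times> 'a) set" where
  "proj_rel = {(u, v). u \<noteq> 0 \<and> v \<noteq> 0 \<and> (\<exists>t. t \<noteq> 0 \<and> u = t *\<^sub>R v)}"

lemma equiv_proj_rel: "equiv (UNIV - {0 :: 'a::real_vector}) proj_rel"
proof (rule equivI)
  show "proj_rel \<subseteq> (UNIV - {0 :: 'a}) \<times> (UNIV - {0})"
    unfolding proj_rel_def by blast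
  show "refl_on (UNIV - {0 :: 'a}) proj_rel"
  proof (rule refl_onI)
    fix x :: 'a
    assume "x \<in> UNIV - {0}"
    moreover have "(1::real) \<noteq> 0" "x = 1 *\<^sub>R x" by simp_all
    ultimately show "(x, x) \<in> proj_rel"
      unfolding proj_rel_def by blast
  qed
  show "sym (proj_rel :: ('a \<times> 'a) set)"
  proof (rule symI)
    fix u v :: 'a
    assume "(u, v) \<in> proj_rel"
    then obtain t where t: "u \<noteq> 0" "v \<noteq> 0" "t \<noteq> 0" "u = t *\<^sub>R v"
      unfolding proj_rel_def by blast
    then have "inverse t \<noteq> 0" "v = inverse t *\<^sub>R u"
      by simp_all
    with t(1,2) show "(v, u) \<in> proj_rel"
      unfolding proj_rel_def by blast
  qed
  show "trans (proj_rel :: ('a \<times> 'a) set)"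
  proof (rule transI)
    fix u v w :: 'a
    assume "(u, v) \<in> proj_rel" "(v, w) \<in> proj_rel"
    then obtain s t where st: "u \<noteq> 0" "w \<noteq> 0" "s \<noteq> 0" "u = s *\<^sub>R v" "t \<noteq> 0" "v = t *\<^sub>R w"
      unfolding proj_rel_def by blast
    then have "s * t \<noteq> 0" "u = (s * t) *\<^sub>R w"
      by simp_all
    with st(1,2) show "(u, w) \<in> proj_rel"
      unfolding proj_rel_def by blast
  qed
qed

definition rho_admissible :: "'a::real_vector set \<Rightarrow> bool" where
  "rho_admissible A \<longleftrightarrow>
     A \<subseteq> UNIV - {0} \<and> (\<forall>C \<in> (UNIV - {0}) // proj_rel. \<exists>!a. a \<in> A \<inter> C)"

text \<open>Meaningful only for nonzero \<open>x\<close> and admissible \<open>A\<close>.\<close>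

definition rep :: "'a::real_vector set \<Rightarrow> 'a \<Rightarrow> 'a" where
  "rep A x = (THE a. a \<in> A \<and> (x, a) \<in> proj_rel)"

text \<open>The topology enters the orthogonality relation only through the requirement that the members
  of \<open>F\<close> be continuous, so it is not a parameter below. The supremum is taken in the extended reals:
  for a function unbounded on \<open>A\<close> it is \<open>\<infinity>\<close>, hence is not attained.\<close>

definition orth_on :: "('a::real_vector \<Rightarrow> real) set \<Rightarrow> 'a set \<Rightarrow> 'a \<Rightarrow> 'a \<Rightarrow> bool" where
  "orth_on F A u v \<longleftrightarrow>
     (\<exists>f\<in>F. ereal (f u) = (SUP z\<in>A. ereal \<bar>f z\<bar>) \<and> (\<forall>l::real. f (l *\<^sub>R v) = 0))"

definition orth :: "('a::real_vector \<Rightarrow> real) set \<Rightarrow> 'a set \<Rightarrow> 'a \<Rightarrow> 'a \<Rightarrow> bool" where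
  "orth F A x y \<longleftrightarrow> x = 0 \<or> y = 0 \<or> orth_on F A (rep A x) (rep A y)"

definition orth_pairs :: "('a::real_vector \<Rightarrow> real) set \<Rightarrow> 'a set \<Rightarrow> ('a \<times> 'a) set" where
  "orth_pairs F A = {(x, y). orth F A x y}"

definition birkhoff_james :: "'a::real_normed_vector \<Rightarrow> 'a \<Rightarrow> bool" where
  "birkhoff_james x y \<longleftrightarrow> (\<forall>l::real. norm x \<le> norm (x + l *\<^sub>R y))"

definition birkhoff_james_pairs :: "('a::real_normed_vector \<times> 'a) set" where
  "birkhoff_james_pairs = {(x, y). birkhoff_james x y}"

end

theory Submission
  imports Defs
begin

text \<open>Normalise the representatives to have norm one and let the family consist of all nonzero
  bounded linear functionals. A functional that attains its supremum over the representatives at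
  \<open>u\<close> attains its norm there, so James' characterisation applies: \<open>u\<close> is Birkhoff-James
  orthogonal to \<open>v\<close> iff some norm-attaining functional at \<open>u\<close> vanishes at \<open>v\<close>. The functional comes
  from the Hahn-Banach theorem, obtained here by showing that a minimal sublinear functional is
  linear.\<close>

section \<open>Sublinear functionals and lower envelopes\<close>

definition sublinear :: "('a::real_vector \<Rightarrow> real) \<Rightarrow> bool" where
  "sublinear q \<longleftrightarrow>
     (\<forall>x y. q (x + y) \<le> q x + q y) \<and> (\<forall>t x. t > 0 \<longrightarrow> q (t *\<^sub>R x) = t * q x)"

text \<open>One inequality for all positive factors suffices: applied to \<open>inverse t\<close> at
  the point \<open>t *\<^sub>R x\<close> it gives the reverse one.\<close>

lemma sublinearI:
  assumes "\<And>x y. q (x + y) \<le> q x + q y"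
    and "\<And>t x. t > 0 \<Longrightarrow> q (t *\<^sub>R x) \<le> t * q x"
  shows "sublinear q"
  unfolding sublinear_def
proof (intro conjI allI impI antisym)
  fix t :: real and x :: 'a
  assume t: "t > 0"
  have "q (inverse t *\<^sub>R (t *\<^sub>R x)) \<le> inverse t * q (t *\<^sub>R x)"
    using assms(2) t by (metis inverse_positive_iff_positive)
  then show "t * q x \<le> q (t *\<^sub>R x)"
    using t by (simp add: field_simps)
qed (use assms in auto)

lemma sublinear_add: "sublinear q \<Longrightarrow> q (x + y) \<le> q x + q y"
  by (simp add: sublinear_def)

lemma sublinear_scale: "sublinear q \<Longrightarrow> t > 0 \<Longrightarrow> q (t *\<^sub>R x) = t * q x"
  by (simp add: sublinear_def)

lemma sublinear_zero:
  assumes "sublinear q" shows "q 0 = 0"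
  using sublinear_scale[OF assms, of 2 0] by simp

lemma sublinear_minus: "sublinear q \<Longrightarrow> - q (- x) \<le> q x"
  using sublinear_add[of q x "- x"] sublinear_zero[of q] by simp

lemma sublinear_norm: "sublinear (norm :: 'a::real_normed_vector \<Rightarrow> real)"
  by (rule sublinearI) (auto simp: norm_triangle_ineq)

text \<open>A pair \<open>(d, c)\<close> in the convex cone \<open>S\<close> encodes the demand that
  a linear functional take a value at least \<open>c\<close> at \<open>d\<close>. Any linear
  \<open>f\<close> below \<open>r\<close> meets it, since
  \<open>f (- d) \<le> r (- d) \<le> q 0 - c = - c\<close>. The envelope \<open>r\<close> is the
  infimum of \<open>q (x + d) - c\<close> over the cone; sums in \<open>S\<close> make it
  subadditive, and multiples make it homogeneous.\<close>

lemma sublinear_lower_envelope: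
  fixes q :: "'a::real_vector \<Rightarrow> real" and S :: "('a \<times> real) set"
  assumes q: "sublinear q"
    and S0: "(0, 0) \<in> S"
    and Sadd: "\<And>s s'. s \<in> S \<Longrightarrow> s' \<in> S \<Longrightarrow> s + s' \<in> S"
    and Sscale: "\<And>t s. t > 0 \<Longrightarrow> s \<in> S \<Longrightarrow> t *\<^sub>R s \<in> S"
    and Sle: "\<And>d c. (d, c) \<in> S \<Longrightarrow> c \<le> q d"
  obtains r where "sublinear r" "r \<le> q" "\<And>d c x. (d, c) \<in> S \<Longrightarrow> r x \<le> q (x + d) - c"
proof -
  define r where "r x = (INF s\<in>S. q (x + fst s) - snd s)" for x
  have bdd: "bdd_below ((\<lambda>s. q (x + fst s) - snd s) ` S)" for x
  \<comment> \<open>The bound \<open>- q (- x)\<close> is independent of \<open>s\<close>: split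
    \<open>fst s\<close> into \<open>x + fst s\<close> and \<open>- x\<close>.\<close>
  proof (rule bdd_belowI2)
    fix s assume "s \<in> S"
    then have "snd s \<le> q (fst s)" using Sle[of "fst s" "snd s"] by simp
    moreover have "q (fst s) \<le> q (x + fst s) + q (- x)"
      using sublinear_add[OF q, of "x + fst s" "- x"] by simp
    ultimately show "- q (- x) \<le> q (x + fst s) - snd s" by linarith
  qed
  have le: "r x \<le> q (x + fst s) - snd s" if "s \<in> S" for x s
    unfolding r_def using bdd that by (rule cINF_lower)
  have ge: "m \<le> r x" if "\<And>s. s \<in> S \<Longrightarrow> m \<le> q (x + fst s) - snd s" for x m
    unfolding r_def using S0 that by (intro cINF_greatest) auto
  have "sublinear r"
  proof (rule sublinearI)
    fix x y
    \<comment> \<open>The terms are moved so that \<open>ge\<close> treats one infimum at a time;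
      the pair \<open>s + s'\<close> then bounds the left side.\<close>
    have "r (x + y) - r y \<le> r x"
    proof (rule ge)
      fix s assume s: "s \<in> S"
      have "r (x + y) - (q (x + fst s) - snd s) \<le> r y"
      proof (rule ge)
        fix s' assume s': "s' \<in> S"
        have "r (x + y) \<le> q ((x + fst s) + (y + fst s')) - (snd s + snd s')"
          using le[OF Sadd[OF s s'], of "x + y"] by (simp add: algebra_simps)
        then show "r (x + y) - (q (x + fst s) - snd s) \<le> q (y + fst s') - snd s'"
          using sublinear_add[OF q, of "x + fst s" "y + fst s'"] by linarith
      qed
      then show "r (x + y) - r y \<le> q (x + fst s) - snd s" by linarith
    qed
    then show "r (x + y) \<le> r x + r y" by linarith
  next
    fix t :: real and x :: 'a
    assume t: "t > 0"
    have "r (t *\<^sub>R x) / t \<le> r x"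
    proof (rule ge)
      fix s assume s: "s \<in> S"
      have "r (t *\<^sub>R x) \<le> q (t *\<^sub>R (x + fst s)) - t * snd s"
        using le[OF Sscale[OF t s], of "t *\<^sub>R x"] by (simp add: algebra_simps)
      then show "r (t *\<^sub>R x) / t \<le> q (x + fst s) - snd s"
        using sublinear_scale[OF q t, of "x + fst s"] t by (simp add: field_simps)
    qed
    then show "r (t *\<^sub>R x) \<le> t * r x"
      using t by (simp add: field_simps)
  qed
  moreover have "r \<le> q"
    using le[OF S0] by (simp add: le_fun_def)
  moreover have "r x \<le> q (x + d) - c" if "(d, c) \<in> S" for d c x
    using le[OF that] by simp
  ultimately show ?thesis by (rule that)
qed

section \<open>The Hahn-Banach theorem through minimal sublinear functionals\<close>

text \<open>The pointwise infimum works. It is finite because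
  \<open>- p (- x) \<le> - q (- x) \<le> q x\<close> for every member \<open>q\<close>.\<close>

lemma sublinear_Inf_chain:
  fixes C :: "('a::real_vector \<Rightarrow> real) set"
  assumes C: "C \<noteq> {}" "\<And>q. q \<in> C \<Longrightarrow> sublinear q" "\<And>q. q \<in> C \<Longrightarrow> q \<le> p"
    and chain: "\<And>q q'. q \<in> C \<Longrightarrow> q' \<in> C \<Longrightarrow> q \<le> q' \<or> q' \<le> q"
  obtains r where "sublinear r" "\<And>q. q \<in> C \<Longrightarrow> r \<le> q"
proof -
  define r where "r x = (INF q\<in>C. q x)" for x
  have bdd: "bdd_below ((\<lambda>q. q x) ` C)" for x
  proof (rule bdd_belowI2)
    fix q assume "q \<in> C"
    then have "- q (- x) \<le> q x" "q (- x) \<le> p (- x)"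
      using C(3) sublinear_minus[OF C(2)] by (simp_all add: le_fun_def)
    then show "- p (- x) \<le> q x" by linarith
  qed
  have le: "r x \<le> q x" if "q \<in> C" for x q
    unfolding r_def using bdd that by (rule cINF_lower)
  have ge: "m \<le> r x" if "\<And>q. q \<in> C \<Longrightarrow> m \<le> q x" for x m
    unfolding r_def using C(1) that by (intro cINF_greatest) auto
  have "sublinear r"
  proof (rule sublinearI)
    fix x y
    have "r (x + y) - r y \<le> r x"
    proof (rule ge)
      fix q assume q: "q \<in> C"
      have "r (x + y) - q x \<le> r y"
      proof (rule ge)
        fix q' assume q': "q' \<in> C"
        \<comment> \<open>The smaller of \<open>q\<close> and \<open>q'\<close> bounds both terms at
          once, so the subadditivity of a single member is enough.\<close>
        obtain m where m: "m \<in> C" "m \<le> q" "m \<le> q'"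
          using chain[OF q q'] q q' by blast
        have "r (x + y) \<le> m x + m y"
          using le[OF m(1), of "x + y"] sublinear_add[OF C(2)[OF m(1)], of x y] by linarith
        then show "r (x + y) - q x \<le> q' y"
          using le_funD[OF m(2), of x] le_funD[OF m(3), of y] by linarith
      qed
      then show "r (x + y) - r y \<le> q x" by linarith
    qed
    then show "r (x + y) \<le> r x + r y" by linarith
  next
    fix t :: real and x :: 'a
    assume t: "t > 0"
    have "r (t *\<^sub>R x) / t \<le> r x"
    proof (rule ge)
      fix q assume q: "q \<in> C"
      show "r (t *\<^sub>R x) / t \<le> q x"
        using le[OF q, of "t *\<^sub>R x"] sublinear_scale[OF C(2)[OF q] t, of x] t
        by (simp add: field_simps)
    qed
    then show "r (t *\<^sub>R x) \<le> t * r x"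
      using t by (simp add: field_simps)
  qed
  moreover have "r \<le> q" if "q \<in> C" for q
    using le[OF that] by (simp add: le_fun_def)
  ultimately show ?thesis by (rule that)
qed

text \<open>Lowering \<open>m\<close> along the ray of \<open>z\<close> gives a sublinear
  \<open>r \<le> m\<close> with \<open>r x \<le> m (x + z) - m z\<close>. Minimality forces
  \<open>r = m\<close>, which is superadditivity.\<close>

lemma minimal_sublinear_imp_linear:
  fixes m :: "'a::real_vector \<Rightarrow> real"
  assumes m: "sublinear m" and min: "\<And>r. sublinear r \<Longrightarrow> r \<le> m \<Longrightarrow> r = m"
  shows "linear m"
proof -
  have add: "m (x + z) = m x + m z" for x z
  proof -
    \<comment> \<open>On this ray the demanded value equals \<open>m\<close>; the restriction to
      \<open>t \<ge> 0\<close> is what positive homogeneity allows.\<close>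
    let ?S = "{(t *\<^sub>R z, t * m z) | t. t \<ge> 0}"
    obtain r where r: "sublinear r" "r \<le> m"
        "\<And>d c x. (d, c) \<in> ?S \<Longrightarrow> r x \<le> m (x + d) - c"
    proof (rule sublinear_lower_envelope[of m ?S])
      show "(0, 0) \<in> ?S" by force
      show "s + s' \<in> ?S" if "s \<in> ?S" "s' \<in> ?S" for s s'
      proof -
        from that obtain t t' where "s = (t *\<^sub>R z, t * m z)" "s' = (t' *\<^sub>R z, t' * m z)" "t \<ge> 0" "t' \<ge> 0"
          by blast
        then have "s + s' = ((t + t') *\<^sub>R z, (t + t') * m z)" "t + t' \<ge> 0"
          by (auto simp: algebra_simps)
        then show ?thesis by blast
      qed
      show "t *\<^sub>R s \<in> ?S" if "t > 0" "s \<in> ?S" for t s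
      proof -
        from that obtain t' where "s = (t' *\<^sub>R z, t' * m z)" "t' \<ge> 0"
          by blast
        then have "t *\<^sub>R s = ((t * t') *\<^sub>R z, (t * t') * m z)" "t * t' \<ge> 0"
          using that(1) by auto
        then show ?thesis by blast
      qed
      show "c \<le> m d" if "(d, c) \<in> ?S" for d c
      proof -
        from that obtain t where t: "d = t *\<^sub>R z" "c = t * m z" "t \<ge> 0" by blast
        show ?thesis
          using sublinear_scale[OF m, of t z] sublinear_zero[OF m] t by (cases "t = 0") auto
      qed
    qed (use m in auto)
    have "(z, m z) \<in> ?S"
      by (intro CollectI exI[of _ 1]) simp
    then have "r x \<le> m (x + z) - m z" by (rule r(3))
    then have "m x \<le> m (x + z) - m z"
      unfolding min[OF r(1,2)] .
    then show ?thesis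
      using sublinear_add[OF m, of x z] by linarith
  qed
  \<comment> \<open>Oddness carries homogeneity over to negative factors.\<close>
  have neg: "m (- x) = - m x" for x
    using add[of x "- x"] sublinear_zero[OF m] by simp
  show ?thesis
  proof (rule linearI)
    show "m (t *\<^sub>R x) = t *\<^sub>R m x" for t x
    proof (cases t "0::real" rule: linorder_cases)
      case less
      then show ?thesis
        using sublinear_scale[OF m, of "- t" x] neg[of "t *\<^sub>R x"] by simp
    next
      case equal
      then show ?thesis using sublinear_zero[OF m] by simp
    next
      case greater
      then show ?thesis using sublinear_scale[OF m] by simp
    qed
  qed (rule add)
qed

text \<open>Zorn's lemma yields a minimal sublinear functional below \<open>p\<close>, and such a
  functional is linear. Values prescribed on a cone enter through the choice of \<open>p\<close> as
  an envelope.\<close>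

lemma linear_below_sublinear:
  fixes p :: "'a::real_vector \<Rightarrow> real"
  assumes p: "sublinear p"
  obtains f where "linear f" "f \<le> p"
proof -
  let ?A = "{q. sublinear q \<and> q \<le> p}"
  \<comment> \<open>The order is reversed, so that the maximal element from Zorn's lemma is a
    minimal functional.\<close>
  let ?P = "\<lambda>q r :: 'a \<Rightarrow> real. r \<le> q"
  have "\<exists>m\<in>?A. \<forall>q\<in>?A. ?P m q \<longrightarrow> q = m"
  proof (rule predicate_Zorn)
    show "partial_order_on ?A (relation_of ?P ?A)"
      by (rule partial_order_on_relation_ofI) auto
    fix C assume C: "C \<in> Chains (relation_of ?P ?A)"
    show "\<exists>u\<in>?A. \<forall>q\<in>C. ?P q u"
    proof (cases "C = {}")
      case True
      then show ?thesis using p by auto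
    next
      case False
      have CA: "sublinear q" "q \<le> p" if "q \<in> C" for q
        using C that by (auto simp: Chains_def relation_of_def)
      obtain r where r: "sublinear r" "\<And>q. q \<in> C \<Longrightarrow> r \<le> q"
        by (rule sublinear_Inf_chain[of C p])
          (use C CA False in \<open>auto simp: Chains_def relation_of_def\<close>)
      moreover from False obtain q where "q \<in> C" by blast
      then have "r \<le> p" using r(2) CA(2) by (metis order_trans)
      ultimately show ?thesis by blast
    qed
  qed
  then obtain m where m: "sublinear m" "m \<le> p" "\<And>q. sublinear q \<Longrightarrow> q \<le> p \<Longrightarrow> q \<le> m \<Longrightarrow> q = m"
    by blast
  have "linear m"
    using m(1)
  proof (rule minimal_sublinear_imp_linear)
    show "r = m" if "sublinear r" "r \<le> m" for r
      using that m(2,3) by (metis order_trans)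
  qed
  then show ?thesis using m(2) by (rule that)
qed

section \<open>Birkhoff-James orthogonality and norm-attaining functionals\<close>

text \<open>Factoring out \<open>s\<close> turns the coefficient \<open>l\<close> into
  \<open>l * t / s\<close>, which the hypothesis covers for every \<open>l\<close>.\<close>

lemma birkhoff_james_scale:
  assumes "birkhoff_james u v" "s \<noteq> 0"
  shows "birkhoff_james (s *\<^sub>R u) (t *\<^sub>R v)"
  unfolding birkhoff_james_def
proof
  fix l :: real
  have "norm (s *\<^sub>R u) \<le> \<bar>s\<bar> * norm (u + (l * t / s) *\<^sub>R v)"
    using assms(1) by (auto simp: birkhoff_james_def intro!: mult_left_mono)
  also have "\<dots> = norm (s *\<^sub>R (u + (l * t / s) *\<^sub>R v))" by simp
  also have "s *\<^sub>R (u + (l * t / s) *\<^sub>R v) = s *\<^sub>R u + l *\<^sub>R t *\<^sub>R v"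
    using assms(2) by (simp add: scaleR_add_right)
  finally show "norm (s *\<^sub>R u) \<le> norm (s *\<^sub>R u + l *\<^sub>R t *\<^sub>R v)" .
qed

text \<open>Orthogonality says exactly that the demands
  \<open>f (a *\<^sub>R u + b *\<^sub>R v) \<ge> a * norm u\<close> with \<open>a \<ge> 0\<close>
  are compatible with the norm. The envelope of the norm for these demands has a linear functional
  below it.\<close>

lemma birkhoff_james_supporting_functional:
  fixes u v :: "'a::real_normed_vector"
  assumes bj: "birkhoff_james u v"
  obtains f where "bounded_linear f" "\<And>x. \<bar>f x\<bar> \<le> norm x" "f u = norm u" "f v = 0"
proof -
  \<comment> \<open>The coefficient \<open>b\<close> takes both signs, so that the demands at
    \<open>v\<close> and \<open>- v\<close> together force \<open>f v = 0\<close>.\<close>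
  let ?S = "{(a *\<^sub>R u + b *\<^sub>R v, a * norm u) | a b. a \<ge> 0}"
  have bj': "a * norm u \<le> norm (a *\<^sub>R u + b *\<^sub>R v)" if "a \<ge> 0" for a b
  proof (cases "a = 0")
    case False
    then have "birkhoff_james (a *\<^sub>R u) v"
      using birkhoff_james_scale[OF bj, of a 1] by simp
    then show ?thesis using that by (auto simp: birkhoff_james_def)
  qed simp
  obtain r where r: "sublinear r" "r \<le> norm"
      "\<And>d c x. (d, c) \<in> ?S \<Longrightarrow> r x \<le> norm (x + d) - c"
  proof (rule sublinear_lower_envelope[of norm ?S])
    show "(0, 0) \<in> ?S" by force
    show "s + s' \<in> ?S" if "s \<in> ?S" "s' \<in> ?S" for s s'
    proof -
      from that obtain a b a' b' where "s = (a *\<^sub>R u + b *\<^sub>R v, a * norm u)"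
        "s' = (a' *\<^sub>R u + b' *\<^sub>R v, a' * norm u)" "a \<ge> 0" "a' \<ge> 0"
        by blast
      then have "s + s' = ((a + a') *\<^sub>R u + (b + b') *\<^sub>R v, (a + a') * norm u)" "a + a' \<ge> 0"
        by (auto simp: algebra_simps)
      then show ?thesis by blast
    qed
    show "t *\<^sub>R s \<in> ?S" if "t > 0" "s \<in> ?S" for t s
    proof -
      from that obtain a b where "s = (a *\<^sub>R u + b *\<^sub>R v, a * norm u)" "a \<ge> 0"
        by blast
      then have "t *\<^sub>R s = ((t * a) *\<^sub>R u + (t * b) *\<^sub>R v, (t * a) * norm u)" "t * a \<ge> 0"
        using that(1) by (auto simp: algebra_simps)
      then show ?thesis by blast
    qed
  qed (use bj' sublinear_norm in auto)
  obtain f where f: "linear f" "f \<le> r"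
    using linear_below_sublinear[OF r(1)] .
  have neg: "f (- x) = - f x" for x
    using f(1) by (rule linear_neg)
  have fn: "f x \<le> norm x" for x
    using f(2) r(2) by (meson le_fun_def order_trans)
  have fS: "a * norm u \<le> f (a *\<^sub>R u + b *\<^sub>R v)" if "a \<ge> 0" for a b
  proof -
    let ?d = "a *\<^sub>R u + b *\<^sub>R v"
    \<comment> \<open>At \<open>- ?d\<close> the norm term of the envelope vanishes and only
      \<open>- (a * norm u)\<close> remains.\<close>
    have "r (- ?d) \<le> norm (- ?d + ?d) - a * norm u"
      by (rule r(3)) (use that in blast)
    moreover have "f (- ?d) \<le> r (- ?d)" using f(2) by (simp only: le_fun_def)
    ultimately show ?thesis unfolding neg by simp
  qed
  have abs: "\<bar>f x\<bar> \<le> norm x" for x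
    using fn[of x] fn[of "- x"] neg[of x] by simp
  show ?thesis
  proof (rule that)
    show "bounded_linear f"
      using f(1) abs by (intro linear_conv_bounded_linear[THEN iffD1] bounded_linear_intro[of _ 1])
        (auto simp: linear_add linear_scale)
    show "f u = norm u"
      using fS[of 1 0] fn[of u] by simp
    show "f v = 0"
      using fS[of 0 1] fS[of 0 "- 1"] neg[of v] by simp
  qed (rule abs)
qed

text \<open>The functional is constant on the line \<open>u + l *\<^sub>R v\<close>, where its value
  \<open>K * norm u\<close> is at most \<open>K\<close> times the norm of each point.\<close>

lemma birkhoff_james_if_functional:
  fixes u v :: "'a::real_normed_vector"
  assumes f: "linear f" "\<And>x. \<bar>f x\<bar> \<le> K * norm x" "f u = K * norm u" "f v = 0" and K: "K > 0"
  shows "birkhoff_james u v"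
  unfolding birkhoff_james_def
proof
  fix l
  have "K * norm u = f (u + l *\<^sub>R v)"
    using f by (simp add: linear_add linear_scale)
  also have "\<dots> \<le> K * norm (u + l *\<^sub>R v)"
    using f(2)[of "u + l *\<^sub>R v"] by linarith
  finally show "norm u \<le> norm (u + l *\<^sub>R v)" using K by simp
qed

section \<open>Weak continuity and normalised representatives\<close>

lemma continuous_map_weak_topology:
  assumes "bounded_linear (f :: 'a::real_normed_vector \<Rightarrow> real)"
  shows "continuous_map weak_topology euclideanreal f"
  unfolding continuous_map_def
proof (intro conjI allI impI)
  fix U :: "real set" assume "openin euclideanreal U"
  then have "openin weak_topology (f -` U)"
    unfolding weak_topology_def using assms
    by (intro topology_generated_by_Basis) auto
  then show "openin weak_topology {x \<in> topspace weak_topology. f x \<in> U}"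
    by (simp add: vimage_def)
qed simp

text \<open>Choose a vector in each class and divide it by its norm, which stays in the class.
  Disjointness of classes gives uniqueness.\<close>

lemma rho_admissible_normalised:
  obtains A :: "'a::real_normed_vector set" where "rho_admissible A" "\<And>a. a \<in> A \<Longrightarrow> norm a = 1"
proof -
  let ?Q = "(UNIV - {0 :: 'a}) // proj_rel"
  define g :: "'a set \<Rightarrow> 'a" where "g C = sgn (SOME z. z \<in> C)" for C
  have g: "g C \<in> C" "norm (g C) = 1" if C: "C \<in> ?Q" for C
  proof -
    have "C \<noteq> {}" using in_quotient_imp_non_empty[OF equiv_proj_rel C] .
    then have z: "(SOME z. z \<in> C) \<in> C" by (simp add: some_in_eq)
    moreover have "C \<subseteq> UNIV - {0}" using in_quotient_imp_subset[OF equiv_proj_rel C] .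
    ultimately have z0: "(SOME z. z \<in> C) \<noteq> 0" by blast
    then show "norm (g C) = 1" by (simp add: g_def norm_sgn)
    have "((SOME z. z \<in> C), g C) \<in> proj_rel"
      using z0 by (auto simp: proj_rel_def g_def sgn_div_norm intro!: exI[of _ "norm (SOME z. z \<in> C)"])
    then show "g C \<in> C"
      using in_quotient_imp_closed[OF equiv_proj_rel C z] by blast
  qed
  have uniq: "C = D" if "C \<in> ?Q" "D \<in> ?Q" "x \<in> C" "x \<in> D" for C D x
    using quotient_disj[OF equiv_proj_rel that(1,2)] that by blast
  show ?thesis
  proof (rule that[of "g ` ?Q"])
    show "rho_admissible (g ` ?Q)"
      unfolding rho_admissible_def
    proof (intro conjI ballI ex1I)
      show "g ` ?Q \<subseteq> UNIV - {0}" using g(2) by fastforce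
      show "g C \<in> g ` ?Q \<inter> C" if "C \<in> ?Q" for C using g(1) that by blast
      show "a = g C" if "C \<in> ?Q" "a \<in> g ` ?Q \<inter> C" for C a
        using that g(1) uniq by blast
    qed
    show "norm a = 1" if "a \<in> g ` ?Q" for a using g(2) that by blast
  qed
qed

text \<open>Admissibility applied to the class of \<open>x\<close> justifies the definite
  description in \<open>rep\<close>.\<close>

lemma rep_admissible:
  assumes A: "rho_admissible A" and x: "x \<noteq> 0"
  shows "rep A x \<in> A" "\<exists>t. t \<noteq> 0 \<and> x = t *\<^sub>R rep A x"
proof -
  have "proj_rel `` {x} \<in> (UNIV - {0}) // proj_rel"
    using x by (intro quotientI) simp
  then have "\<exists>!a. a \<in> A \<inter> proj_rel `` {x}"
    using A unfolding rho_admissible_def by (elim conjE bspec)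
  then have "\<exists>!a. a \<in> A \<and> (x, a) \<in> proj_rel"
    by (simp only: Int_iff Image_singleton_iff)
  then have "rep A x \<in> A \<and> (x, rep A x) \<in> proj_rel"
    unfolding rep_def by (rule theI')
  then show "rep A x \<in> A" "\<exists>t. t \<noteq> 0 \<and> x = t *\<^sub>R rep A x"
    by (auto simp: proj_rel_def)
qed

lemma birkhoff_james_rep:
  fixes x y :: "'a::real_normed_vector"
  assumes "rho_admissible A" "x \<noteq> 0" "y \<noteq> 0"
  shows "birkhoff_james (rep A x) (rep A y) \<longleftrightarrow> birkhoff_james x y"
proof -
  obtain s t where s: "s \<noteq> 0" "x = s *\<^sub>R rep A x" and t: "t \<noteq> 0" "y = t *\<^sub>R rep A y"
    using rep_admissible(2) assms by metis
  have "rep A x = inverse s *\<^sub>R x" "rep A y = inverse t *\<^sub>R y"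
    using s t by (metis scaleR_scaleR left_inverse scaleR_one)+
  then show ?thesis
    using birkhoff_james_scale s t
    by (metis inverse_nonzero_iff_nonzero)
qed

section \<open>Comparison of the two orthogonality relations\<close>

text \<open>Every line through the origin meets \<open>A\<close> in a unit vector, so the supremum
  of \<open>\<bar>f z\<bar>\<close> over \<open>A\<close> is the operator norm of \<open>f\<close>.
  Condition (i) thus says that \<open>f\<close> attains its norm at \<open>u\<close>.\<close>

lemma orth_on_iff_birkhoff_james:
  fixes A :: "'a::real_normed_vector set"
  assumes A: "rho_admissible A" "\<And>a. a \<in> A \<Longrightarrow> norm a = 1" and u: "u \<in> A"
  shows "orth_on {f. bounded_linear f \<and> f \<noteq> (\<lambda>_. 0)} A u v \<longleftrightarrow> birkhoff_james u v"
proof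
  assume "orth_on {f. bounded_linear f \<and> f \<noteq> (\<lambda>_. 0)} A u v"
  then obtain f where f: "bounded_linear f" "f \<noteq> (\<lambda>_. 0)"
    "ereal (f u) = (SUP z\<in>A. ereal \<bar>f z\<bar>)" "\<And>l. f (l *\<^sub>R v) = 0"
    unfolding orth_on_def by blast
  have lin: "linear f" using f(1) by (rule bounded_linear.linear)
  have le: "\<bar>f z\<bar> \<le> f u" if "z \<in> A" for z
  proof -
    have "ereal \<bar>f z\<bar> \<le> ereal (f u)" unfolding f(3) using that by (rule SUP_upper)
    then show ?thesis by simp
  qed
  \<comment> \<open>Homogeneity extends the bound from the representatives to the whole
    space.\<close>
  have bound: "\<bar>f x\<bar> \<le> f u * norm x" for x
  proof (cases "x = 0")
    case True
    then show ?thesis using linear_0[OF lin] by simp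
  next
    case False
    then obtain t where t: "x = t *\<^sub>R rep A x" using rep_admissible(2)[OF A(1)] by blast
    have a: "rep A x \<in> A" using rep_admissible(1)[OF A(1) False] .
    have "\<bar>f x\<bar> = \<bar>t\<bar> * \<bar>f (rep A x)\<bar>"
      by (subst t) (simp add: linear_scale[OF lin] abs_mult)
    also have "\<dots> \<le> \<bar>t\<bar> * f u" using le[OF a] by (intro mult_left_mono) auto
    also have "\<bar>t\<bar> = norm x" by (subst t) (simp add: A(2)[OF a])
    finally show ?thesis by (simp add: mult.commute)
  qed
  \<comment> \<open>Here the exclusion of the zero functional enters: it would satisfy (i) and (ii)
    for every pair.\<close>
  have "f u > 0"
  proof (rule ccontr)
    assume "\<not> f u > 0"
    moreover have "f u \<ge> 0" using le[OF u] by linarith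
    ultimately have "f u = 0" by linarith
    then have "f = (\<lambda>_. 0)" using bound by auto
    with f(2) show False ..
  qed
  moreover have "f u = f u * norm u" using A(2)[OF u] by simp
  moreover have "f v = 0" using f(4)[of 1] by simp
  ultimately show "birkhoff_james u v"
    using birkhoff_james_if_functional[OF lin bound] by blast
next
  assume "birkhoff_james u v"
  then obtain f where f: "bounded_linear f" "\<And>x. \<bar>f x\<bar> \<le> norm x" "f u = norm u" "f v = 0"
    using birkhoff_james_supporting_functional by blast
  have "(SUP z\<in>A. ereal \<bar>f z\<bar>) = ereal (f u)"
  proof (rule antisym)
    show "(SUP z\<in>A. ereal \<bar>f z\<bar>) \<le> ereal (f u)"
      \<comment> \<open>For \<open>z\<close> in \<open>A\<close>,
        \<open>\<bar>f z\<bar> \<le> norm z = 1 = norm u = f u\<close>.\<close>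
      using f(2,3) A(2) u by (intro SUP_least) (metis ereal_less_eq(3))
    show "ereal (f u) \<le> (SUP z\<in>A. ereal \<bar>f z\<bar>)"
      using u by (intro SUP_upper2[of u]) auto
  qed
  moreover have "f (l *\<^sub>R v) = 0" for l
    using f(4) linear_scale[OF bounded_linear.linear[OF f(1)]] by simp
  moreover have "f \<noteq> (\<lambda>_. 0)" using f(3) A(2)[OF u] by auto
  ultimately show "orth_on {f. bounded_linear f \<and> f \<noteq> (\<lambda>_. 0)} A u v"
    unfolding orth_on_def using f(1) by auto
qed

theorem theorem2p3:
  fixes B :: "'a::banach set"
  assumes "independent B" and "span B = UNIV" and "infinite B \<or> card B > 1"
  shows "\<exists>(F :: ('a \<Rightarrow> real) set) (A :: 'a set).
           (\<forall>f\<in>F. continuous_map weak_topology euclideanreal f) \<and>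
           rho_admissible A \<and>
           birkhoff_james_pairs = orth_pairs F A"
proof -
  obtain A :: "'a set" where A: "rho_admissible A" "\<And>a. a \<in> A \<Longrightarrow> norm a = 1"
    using rho_admissible_normalised by blast
  let ?F = "{f :: 'a \<Rightarrow> real. bounded_linear f \<and> f \<noteq> (\<lambda>_. 0)}"
  have "birkhoff_james x y \<longleftrightarrow> orth ?F A x y" for x y
  proof (cases "x = 0 \<or> y = 0")
    \<comment> \<open>Both relations hold when either vector is zero.\<close>
    case True
    then show ?thesis by (auto simp: orth_def birkhoff_james_def)
  next
    \<comment> \<open>Both sides reduce to the representatives, Birkhoff-James orthogonality by its
      invariance under scaling.\<close>
    case False
    then show ?thesis
      using orth_on_iff_birkhoff_james[OF A rep_admissible(1)[OF A(1)]] birkhoff_james_rep[OF A(1)]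
      by (simp add: orth_def)
  qed
  then have "birkhoff_james_pairs = orth_pairs ?F A"
    by (simp add: birkhoff_james_pairs_def orth_pairs_def)
  then show ?thesis
    using A(1) continuous_map_weak_topology by (intro exI[of _ ?F] exI[of _ A]) auto
qed

end
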